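(* There is an absolute constant $C>0$ (one may take $C=16\,(4!)^2$) such that the following holds. Let $\Pi$ be a projective plane of order $q\ge 3$, and let $(K,\mathrm{val})$ be a valued field whose residue field $k$ has characteristic different from $3$. If $\mathrm{Kapr}(I(\Pi))\le 3$, then every rank-$\le 3$ lift $F$ of $I(\Pi)$ over $K$ satisfies $$|\mathcal R_{\mathrm{def}}(F)|\ \ge\ \frac{N_{\mathrm{id}}^{\mathrm{ord}}(\Pi)}{C(q+1)^4}.$$ In particular, $|\mathcal R_{\mathrm{def}}(F)|=\Omega(q^8)$, i.e. there is an absolute constant $c>0$ such that $|\mathcal R_{\mathrm{def}}(F)|\ge c\,q^8$ for all such $\Pi$, $q\ge 3$, $K$ and $F$.
   Context: A projective plane $\Pi$ of order $q$ has a finite point set $P$ and line set $L$ with $|P|=|L|=q^2+q+1$; any two distinct points lie on a unique line, any two distinct lines meet in a unique point, there exist four points no three collinear, and each line contains $q+1$ points (each point lies on $q+1$ lines). Its incidence matrix $I(\Pi)\in\{0,1\}^{P\times L}$ has $I(\Pi)_{p\ell}=1$ iff $p\in\ell$. $(K,\mathrm{val})$ is a non-archimedean valued field with value group in $\mathbb R$, valuation ring $R_K$, maximal ideal $\mathfrak m_K$, residue field $k=R_K/\mathfrak m_K$. A lift of $I(\Pi)$ is a matrix $F\in K^{P\times L}$ with $\mathrm{val}(F_{p\ell})=I(\Pi)_{p\ell}$ for all $(p,\ell)$ (so valuation $1$ at incidences and $0$ at nonincidences); it is a rank-$\le 3$ lift if its rank over $K$ is at most $3$. $\mathrm{Kapr}(I(\Pi))$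 is the minimum rank of a lift of $I(\Pi)$ over $K$. A $0$-rectangle is a set $R=\{p,q'\}\times\{\ell,m\}$ with $p\ne q'$ points, $\ell\neq m$ lines, and $p,q'\notin \ell\cup m$. For a lift $F$, let $u_{x,n}\in k^*$ be the residue of $F_{x,n}$ for nonincident $(x,n)$, and set $\rho_F(R)=\dfrac{u_{p,\ell}u_{q',m}}{u_{p,m}u_{q',\ell}}\in k^*$ (defined up to inversion; the condition $\rho_F(R)\ne 1$ is well defined). The defect set is $\mathcal R_{\mathrm{def}}(F)=\{R \text{ a } 0\text{-rectangle}:\rho_F(R)\neq 1\}$. $N_{\mathrm{id}}^{\mathrm{ord}}(\Pi)$ is the number of ordered tuples $(P_1,P_2,P_3,P_4;L_1,L_2,L_3,L_4)$ such that $P_1,\dots,P_4$ are points no three of which are collinear, and each $L_i$ is a line with $P_i\in L_i$ and $P_j\notin L_i$ for $j\ne i$ (equivalently, the submatrix of $I(\Pi)$ with rows $(P_1,\dots,P_4)$ and columns $(L_1,\dots,L_4)$ is the identity matrix $I_4$). *)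

theory Defs
  imports
    "HOL-Analysis.Analysis"
    "HOL-Library.Extended_Nat"
    "HOL-Algebra.Algebraic_Closure_Type"
begin

section \<open>Projective planes\<close>

text \<open>
  The points and the lines of a plane are the elements of two finite types; \<open>incid p l\<close> says that
  the point \<open>p\<close> lies on the line \<open>l\<close>.
\<close>

definition no_three_collinear :: "('p \<Rightarrow> 'l \<Rightarrow> bool) \<Rightarrow> (4 \<Rightarrow> 'p) \<Rightarrow> bool" where
  "no_three_collinear incid P \<longleftrightarrow>
     inj P \<and>
     (\<forall>i j k. i \<noteq> j \<and> i \<noteq> k \<and> j \<noteq> k \<longrightarrow>
        \<not> (\<exists>l. incid (P i) l \<and> incid (P j) l \<and> incid (P k) l))"

locale projective_plane =
  fixes incid :: "'p::finite \<Rightarrow> 'l::finite \<Rightarrow> bool" and q :: nat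
  assumes card_points: "CARD('p) = q\<^sup>2 + q + 1"
    and card_lines: "CARD('l) = q\<^sup>2 + q + 1"
    and unique_line: "p \<noteq> p' \<Longrightarrow> \<exists>!l. incid p l \<and> incid p' l"
    and unique_point: "l \<noteq> l' \<Longrightarrow> \<exists>!p. incid p l \<and> incid p l'"
    and four_points: "\<exists>P. no_three_collinear incid P"
    and card_points_on_line: "card {p. incid p l} = q + 1"
    and card_lines_through_point: "card {l. incid p l} = q + 1"

definition incidence_matrix :: "('p::finite \<Rightarrow> 'l::finite \<Rightarrow> bool) \<Rightarrow> real ^ 'l ^ 'p" where
  "incidence_matrix incid = (\<chi> p l. if incid p l then 1 else 0)"

definition N_id_ord :: "('p::finite \<Rightarrow> 'l::finite \<Rightarrow> bool) \<Rightarrow> nat" where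
  "N_id_ord incid =
     card {(P :: 4 \<Rightarrow> 'p, L :: 4 \<Rightarrow> 'l).
       no_three_collinear incid P \<and>
       (\<forall>i. incid (P i) (L i)) \<and>
       (\<forall>i j. j \<noteq> i \<longrightarrow> \<not> incid (P j) (L i))}"


section \<open>Valued fields and their residue fields\<close>

locale real_valuation =
  fixes val :: "'a::field \<Rightarrow> ereal"
  assumes val_eq_PInf_iff: "val x = \<infinity> \<longleftrightarrow> x = 0"
    and val_not_MInf: "val x \<noteq> -\<infinity>"
    and val_mult: "val (x * y) = val x + val y"
    and val_add: "min (val x) (val y) \<le> val (x + y)"

definition valuation_ring :: "('a::field \<Rightarrow> ereal) \<Rightarrow> 'a ring" where
  "valuation_ring val = ring_of_type_algebra\<lparr>carrier := {x. 0 \<le> val x}\<rparr>"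

definition maximal_ideal_of :: "('a::field \<Rightarrow> ereal) \<Rightarrow> 'a set" where
  "maximal_ideal_of val = {x. 0 < val x}"

definition residue_field :: "('a::field \<Rightarrow> ereal) \<Rightarrow> 'a set ring" where
  "residue_field val = valuation_ring val Quot maximal_ideal_of val"

definition residue_of :: "('a::field \<Rightarrow> ereal) \<Rightarrow> 'a \<Rightarrow> 'a set" where
  "residue_of val x = maximal_ideal_of val +>\<^bsub>valuation_ring val\<^esub> x"

text \<open>
  The counterpart of \<open>CHAR('a)\<close> for a ring given by its carrier: the nonnegative generator of the
  ideal of all integers that vanish in the ring.
\<close>

definition ring_characteristic :: "('a, 'm) ring_scheme \<Rightarrow> nat" where
  "ring_characteristic R = Gcd {n :: nat. add_pow R n \<one>\<^bsub>R\<^esub> = \<zero>\<^bsub>R\<^esub>}"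


section \<open>Lifts and Kapranov rank\<close>

definition is_lift :: "('a::field \<Rightarrow> ereal) \<Rightarrow> real ^ 'n ^ 'm \<Rightarrow> 'a ^ 'n ^ 'm \<Rightarrow> bool" where
  "is_lift val M F \<longleftrightarrow> (\<forall>i j. val (F $ i $ j) = ereal (M $ i $ j))"

text \<open>The value is \<open>\<infinity>\<close> if there is no lift.\<close>

definition kapranov_rank :: "('a::field \<Rightarrow> ereal) \<Rightarrow> real ^ 'n ^ 'm \<Rightarrow> enat" where
  "kapranov_rank val M = (INF F \<in> {F. is_lift val M F}. enat (rank F))"


section \<open>Zero-rectangles and the defect set\<close>

definition is_zero_rectangle ::
  "('p \<Rightarrow> 'l \<Rightarrow> bool) \<Rightarrow> 'p \<Rightarrow> 'p \<Rightarrow> 'l \<Rightarrow> 'l \<Rightarrow> bool" where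
  "is_zero_rectangle incid p p' l m \<longleftrightarrow>
     p \<noteq> p' \<and> l \<noteq> m \<and>
     \<not> incid p l \<and> \<not> incid p m \<and> \<not> incid p' l \<and> \<not> incid p' m"

definition rect_ratio ::
  "('a::field \<Rightarrow> ereal) \<Rightarrow> 'a ^ 'l ^ 'p \<Rightarrow> 'p \<Rightarrow> 'p \<Rightarrow> 'l \<Rightarrow> 'l \<Rightarrow> 'a set" where
  "rect_ratio val F p p' l m =
     (let k = residue_field val; u = (\<lambda>x n. residue_of val (F $ x $ n))
      in (u p l \<otimes>\<^bsub>k\<^esub> u p' m) \<otimes>\<^bsub>k\<^esub> inv\<^bsub>k\<^esub> (u p m \<otimes>\<^bsub>k\<^esub> u p' l))"

text \<open>
  Rectangles are unordered, i.e. sets \<open>{p, p'} \<times> {l, m}\<close>. Renaming the two points or the two lines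
  inverts \<^const>\<open>rect_ratio\<close>, so that the condition does not depend on the chosen representation.
\<close>

definition defect_set ::
  "('p \<Rightarrow> 'l \<Rightarrow> bool) \<Rightarrow> ('a::field \<Rightarrow> ereal) \<Rightarrow> 'a ^ 'l ^ 'p \<Rightarrow> ('p \<times> 'l) set set" where
  "defect_set incid val F =
     {{p, p'} \<times> {l, m} | p p' l m.
        is_zero_rectangle incid p p' l m \<and>
        rect_ratio val F p p' l m \<noteq> \<one>\<^bsub>residue_field val\<^esub>}"

end

theory Submission
  imports Defs
begin

text \<open>
  Restrict a lift of rank at most 3 to the rows and columns of an identity submatrix of order 4: the
  determinant vanishes, the diagonal entries lie in the maximal ideal and the other entries are units.
  If all zero-rectangles inside were non-defective, then the determinant would be congruent to
  \<open>-3 t\<close> for a unit \<open>t\<close>, which is impossible in residue characteristic other than 3. Hence every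
  identity submatrix contains a defect rectangle. A rectangle lies in at most \<open>256 (q + 1)\<^sup>4\<close>
  ordered identity submatrices: once its rows and columns are placed, the other two points lie on its
  lines and the other two lines pass through its points.
\<close>

section \<open>Valuations and residues\<close>

context real_valuation
begin

lemma val_zero [simp]: "val 0 = \<infinity>"
  by (simp add: val_eq_PInf_iff)

lemma val_one [simp]: "val 1 = 0"
proof -
  have "val 1 = val 1 + val 1"
    using val_mult [of 1 1] by simp
  moreover have "val 1 \<noteq> \<infinity>" "val 1 \<noteq> -\<infinity>"
    using val_eq_PInf_iff [of 1] val_not_MInf [of 1] by auto
  ultimately show ?thesis
    by (cases "val 1") auto
qed

lemma val_minus [simp]: "val (- x) = val x"
proof -
  have "val (-1) + val (-1) = 0"
    using val_mult [of "-1" "-1"] by simp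
  then have "val (-1) = 0"
    by (cases "val (-1)") auto
  then show ?thesis
    using val_mult [of "-1" x] by simp
qed

lemma val_nonneg_add: "0 \<le> val x \<Longrightarrow> 0 \<le> val y \<Longrightarrow> 0 \<le> val (x + y)"
  using val_add [of x y] by (simp add: min_def split: if_splits)

lemma val_pos_add: "0 < val x \<Longrightarrow> 0 < val y \<Longrightarrow> 0 < val (x + y)"
  using val_add [of x y] by (simp add: min_def split: if_splits)

lemma val_pos_diff: "0 < val x \<Longrightarrow> 0 < val y \<Longrightarrow> 0 < val (x - y)"
  using val_pos_add [of x "- y"] by simp

lemma val_pos_mult: "0 < val x \<Longrightarrow> 0 \<le> val y \<Longrightarrow> 0 < val (x * y)"
  by (simp add: val_mult add_pos_nonneg)

lemma val_of_nat_nonneg: "0 \<le> val (of_nat n)"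
  by (induction n) (auto intro: val_nonneg_add)

section \<open>The valuation ring, its maximal ideal and the residue map\<close>

lemma carrier_valuation_ring [simp]: "carrier (valuation_ring val) = {x. 0 \<le> val x}"
  by (simp add: valuation_ring_def)

lemma valuation_ring_simps [simp]:
  "mult (valuation_ring val) x y = x * y"
  "add (valuation_ring val) x y = x + y"
  "one (valuation_ring val) = 1"
  "zero (valuation_ring val) = 0"
  by (simp_all add: valuation_ring_def ring_of_type_algebra_def)

lemma cring_valuation_ring: "cring (valuation_ring val)"
proof (rule cringI)
  show "abelian_group (valuation_ring val)"
  proof (rule abelian_groupI)
    fix x
    assume "x \<in> carrier (valuation_ring val)"
    then show "\<exists>y\<in>carrier (valuation_ring val).
      y \<oplus>\<^bsub>valuation_ring val\<^esub> x = \<zero>\<^bsub>valuation_ring val\<^esub>"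
      by (intro bexI [of _ "- x"]) auto
  qed (auto intro: val_nonneg_add)
  show "Group.comm_monoid (valuation_ring val)"
    by (rule comm_monoidI) (auto simp: val_mult)
qed (simp add: distrib_right)

lemma ideal_maximal_ideal_of: "ideal (maximal_ideal_of val) (valuation_ring val)"
proof (rule idealI)
  interpret R: cring "valuation_ring val"
    by (rule cring_valuation_ring)
  show "ring (valuation_ring val)"
    by (rule R.ring_axioms)
  \<comment> \<open>\<open>a_inv\<close> is a description over the carrier, so it is first
    identified with the minus of the field.\<close>
  have neg: "\<ominus>\<^bsub>valuation_ring val\<^esub> x = - x" if "0 < val x" for x
    using that by (intro R.minus_equality) auto
  show "subgroup (maximal_ideal_of val) (add_monoid (valuation_ring val))"
    by (rule R.add.subgroupI)
       (use neg in \<open>auto simp: maximal_ideal_of_def val_pos_add a_inv_def [symmetric]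
         intro!: exI [of _ 0]\<close>)
qed (auto simp: maximal_ideal_of_def val_mult add_pos_nonneg add_nonneg_pos)

lemma residue_of_ring_hom: "ring_hom_cring (valuation_ring val) (residue_field val) (residue_of val)"
proof -
  have "residue_of val = (+>\<^bsub>valuation_ring val\<^esub>) (maximal_ideal_of val)"
    by (simp add: residue_of_def fun_eq_iff)
  then show ?thesis
    using ideal.rcos_ring_hom_cring [OF ideal_maximal_ideal_of cring_valuation_ring]
    by (simp add: residue_field_def)
qed

lemma residue_of_eq_iff:
  assumes "0 \<le> val x" "0 \<le> val y"
  shows "residue_of val x = residue_of val y \<longleftrightarrow> 0 < val (x - y)"
proof -
  interpret I: ideal "maximal_ideal_of val" "valuation_ring val"
    by (rule ideal_maximal_ideal_of)
  have minus: "x \<ominus>\<^bsub>valuation_ring val\<^esub> y = x - y"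
    using assms I.add.m_closed 
    by (metis (no_types, lifting) I.minus_equality I.minus_eq carrier_valuation_ring diff_conv_add_uminus
      left_minus mem_Collect_eq val_minus valuation_ring_simps(2,4))
  have "residue_of val x = residue_of val y \<longleftrightarrow> x \<ominus>\<^bsub>valuation_ring val\<^esub> y \<in> maximal_ideal_of val"
    unfolding residue_of_def
    using I.quotient_eq_iff_same_a_r_cos [OF I.ideal_axioms, of x y] assms by simp
  then show ?thesis
    by (simp add: minus maximal_ideal_of_def)
qed

text \<open>Turns the multiplicative condition in the definition of a defect into a congruence
  modulo the maximal ideal, the form that can be used on the terms of a determinant.\<close>

lemma residue_product_ratio_eq_one_imp:
  assumes val: "val a = 0" "val b = 0" "val c = 0" "val d = 0"
    and ratio: "(residue_of val a \<otimes>\<^bsub>residue_field val\<^esub> residue_of val b) \<otimes>\<^bsub>residue_field val\<^esub>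
      inv\<^bsub>residue_field val\<^esub> (residue_of val c \<otimes>\<^bsub>residue_field val\<^esub> residue_of val d)
      = \<one>\<^bsub>residue_field val\<^esub>"
  shows "0 < val (a * b - c * d)"
proof -
  interpret h: ring_hom_cring "valuation_ring val" "residue_field val" "residue_of val"
    by (rule residue_of_ring_hom)
  have nz: "c * d \<noteq> 0" and vcd: "val (c * d) = 0" and vab: "val (a * b) = 0"
    using val val_mult by auto
  \<comment> \<open>\<open>inv\<close> in the residue field is a description, meaningful only at
    units. The inverse of \<open>c * d\<close> in the field has value 0, so its residue shows that
    the residue of \<open>c * d\<close> is a unit and can be cancelled.\<close>
  define e where "e = inverse (c * d)"
  have e: "c * d * e = 1"
    unfolding e_def by (rule right_inverse [OF nz])
  have ve: "val e = 0"
    using val_mult [of "c * d" e] by (simp add: e vcd)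
  let ?x = "residue_of val (a * b)" and ?y = "residue_of val (c * d)" and ?z = "residue_of val e"
  have closed: "?x \<in> carrier (residue_field val)" "?y \<in> carrier (residue_field val)"
      "?z \<in> carrier (residue_field val)"
    by (rule h.hom_closed; simp add: vcd vab ve)+
  have "?y \<otimes>\<^bsub>residue_field val\<^esub> ?z = \<one>\<^bsub>residue_field val\<^esub>"
    using h.hom_mult [of "c * d" e] h.hom_one by (simp add: vcd ve e)
  then have unit: "?y \<in> Units (residue_field val)"
    using closed h.S.Units_one_closed h.S.unit_factor by metis
  have "?x \<otimes>\<^bsub>residue_field val\<^esub> inv\<^bsub>residue_field val\<^esub> ?y = \<one>\<^bsub>residue_field val\<^esub>"
    using ratio h.hom_mult [of a b] h.hom_mult [of c d] val by simp
  then have "?x = ?y"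
    using unit closed
    by (metis h.S.Units_inv_Units h.S.Units_inv_inv h.S.inv_eq_one_eq h.S.m_comm h.S.Units_closed h.S.inv_unique' h.S.Units_inv_closed)
  then show ?thesis
    using residue_of_eq_iff [of "a * b" "c * d"] vab vcd by simp
qed

section \<open>The residue characteristic\<close>

lemma add_pow_residue_one:
  "add_pow (residue_field val) n \<one>\<^bsub>residue_field val\<^esub> = residue_of val (of_nat n)"
proof -
  interpret h: ring_hom_cring "valuation_ring val" "residue_field val" "residue_of val"
    by (rule residue_of_ring_hom)
  show ?thesis
  proof (induction n)
    case 0
    then show ?case using h.hom_zero by simp
  next
    case (Suc n)
    then show ?case
      using h.hom_add [of "of_nat n" 1] h.hom_one val_of_nat_nonneg [of n]
      by (simp add: h.S.add.nat_pow_Suc add.commute)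
  qed
qed

text \<open>The naturals vanishing in the residue field are those of positive value. If one of them
  were prime to \<open>p\<close>, Bezout would put 1 into the maximal ideal. So all are multiples of
  \<open>p\<close>, and \<open>p\<close> itself is among them.\<close>

lemma val_of_nat_prime_pos_imp_ring_characteristic:
  assumes "normalization_semidom_class.prime p" "0 < val (of_nat p)"
  shows "ring_characteristic (residue_field val) = p"
proof -
  interpret h: ring_hom_cring "valuation_ring val" "residue_field val" "residue_of val"
    by (rule residue_of_ring_hom)
  have "{n. add_pow (residue_field val) n \<one>\<^bsub>residue_field val\<^esub> = \<zero>\<^bsub>residue_field val\<^esub>} = {n. 0 < val (of_nat n)}"
    using residue_of_eq_iff [of "of_nat _" 0] h.hom_zero val_of_nat_nonneg 
    by (simp add: add_pow_residue_one)
  moreover have "p dvd n" if "0 < val (of_nat n)" for n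
  proof (rule ccontr)
    assume "\<not> p dvd n"
    then have "coprime p n"
      using assms(1) by (simp add: prime_imp_coprime)
    then obtain x y where xy: "n * x = p * y + 1"
      using coprime_bezout_strong [of n p] assms(1) not_prime_1 by (metis coprime_commute)
    have "(of_nat n * of_nat x - of_nat p * of_nat y :: 'a) = 1"
      using arg_cong [OF xy, of "of_nat :: nat \<Rightarrow> 'a"] by simp
    moreover have "0 < val (of_nat n * of_nat x - of_nat p * of_nat y)"
      by (intro val_pos_diff val_pos_mult assms that val_of_nat_nonneg)
    ultimately show False by simp
  qed
  ultimately show ?thesis
    using assms(2) unfolding ring_characteristic_def
    by (auto intro!: dvd_antisym Gcd_greatest Gcd_dvd)
qed

end

section \<open>Determinants of order 4\<close>

lemma det_4:
  fixes A :: "4 \<Rightarrow> 4 \<Rightarrow> 'a::comm_ring_1"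
  shows "det (\<chi> i j. A i j) =
   A 1 1 * A 2 2 * A 3 3 * A 4 4
    + A 1 1 * A 2 3 * A 3 4 * A 4 2
    + A 1 1 * A 2 4 * A 3 2 * A 4 3
    + A 1 2 * A 2 1 * A 3 4 * A 4 3
    + A 1 2 * A 2 3 * A 3 1 * A 4 4
    + A 1 2 * A 2 4 * A 3 3 * A 4 1
    + A 1 3 * A 2 1 * A 3 2 * A 4 4
    + A 1 3 * A 2 2 * A 3 4 * A 4 1
    + A 1 3 * A 2 4 * A 3 1 * A 4 2
    + A 1 4 * A 2 1 * A 3 3 * A 4 2
    + A 1 4 * A 2 2 * A 3 1 * A 4 3
    + A 1 4 * A 2 3 * A 3 2 * A 4 1
    - A 1 1 * A 2 2 * A 3 4 * A 4 3
    - A 1 1 * A 2 3 * A 3 2 * A 4 4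
    - A 1 1 * A 2 4 * A 3 3 * A 4 2
    - A 1 2 * A 2 1 * A 3 3 * A 4 4
    - A 1 2 * A 2 3 * A 3 4 * A 4 1
    - A 1 2 * A 2 4 * A 3 1 * A 4 3
    - A 1 3 * A 2 1 * A 3 4 * A 4 2
    - A 1 3 * A 2 2 * A 3 1 * A 4 4
    - A 1 3 * A 2 4 * A 3 2 * A 4 1
    - A 1 4 * A 2 1 * A 3 2 * A 4 3
    - A 1 4 * A 2 2 * A 3 3 * A 4 1
    - A 1 4 * A 2 3 * A 3 1 * A 4 2"
proof -
  \<comment> \<open>The Leibniz sum is split by peeling off 1, 2 and 3 in turn: a permutation of the
    enlarged set is a swap of the new element after a permutation of the rest.\<close>
  have f1: "finite {2::4, 3, 4}" "1 \<notin> {2::4, 3, 4}" by auto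
  have f2: "finite {3::4, 4}" "2 \<notin> {3::4, 4}" by auto
  have f3: "finite {4::4}" "3 \<notin> {4::4}" by auto
  show ?thesis
    unfolding det_def UNIV_4
      sum_over_permutations_insert [OF f1] sum_over_permutations_insert [OF f2]
      sum_over_permutations_insert [OF f3] permutes_sing
    by (simp add: sign_swap_id permutation_swap_id permutation_compose sign_compose sign_id swap_id_eq)
qed

text \<open>If the submatrix were invertible, forming linear combinations of the rows of
  \<open>F\<close> chosen by \<open>r\<close> would be injective, so the row space would have
  dimension at least \<open>CARD('n)\<close>.\<close>

lemma det_submatrix_eq_0:
  fixes F :: "'a::field ^ 'l ^ 'p" and r :: "'n::finite \<Rightarrow> 'p" and c :: "'n \<Rightarrow> 'l"
  assumes "rank F < CARD('n)"
  shows "det (\<chi> i j. F $ r i $ c j) = 0"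
proof (rule ccontr)
  let ?A = "\<chi> i j. F $ r i $ c j" and ?M = "transpose (\<chi> i. F $ r i)"
  assume "det ?A \<noteq> 0"
  then have "invertible (transpose ?A)"
    unfolding invertible_det_nz det_transpose .
  then obtain B where B: "B ** transpose ?A = mat 1"
    unfolding invertible_def by blast
  \<comment> \<open>\<open>?M *v x\<close> combines full rows of \<open>F\<close> with coefficients
    \<open>x\<close>. Its coordinates at the columns \<open>c\<close> alone already determine
    \<open>x\<close> through the left inverse \<open>B\<close>.\<close>
  have restrict: "transpose ?A *v x = (\<chi> j. (?M *v x) $ c j)" for x
    by (simp add: matrix_vector_mult_def transpose_def)
  have "inj ((*v) ?M)"
  proof (rule injI)
    fix x y
    assume "?M *v x = ?M *v y"
    then have "B *v (transpose ?A *v x) = B *v (transpose ?A *v y)"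
      by (simp only: restrict)
    then show "x = y"
      by (simp only: matrix_vector_mul_assoc B matrix_vector_mul_lid)
  qed
  then have "vec.dim (range ((*v) ?M)) = vec.dim (UNIV :: ('a ^ 'n) set)"
    by (intro vec.dim_image_eq) (auto simp: inj_on_def)
  moreover have "range ((*v) ?M) \<subseteq> vec.span (rows F)"
  proof clarify
    fix x
    have "?M *v x = (\<Sum>i\<in>UNIV. x $ i *s F $ r i)"
      by (simp add: matrix_mult_sum column_def transpose_def vec_eq_iff)
    also have "\<dots> \<in> vec.span (rows F)"
      by (intro vec.span_sum vec.span_scale vec.span_base) (auto simp: rows_def row_def)
    finally show "?M *v x \<in> vec.span (rows F)" .
  qed
  then have "vec.dim (range ((*v) ?M)) \<le> rank F"
    unfolding row_rank_def_gen using vec.dim_subset vec.dim_span by metis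
  ultimately show False
    using assms by (simp add: card_cart_basis)
qed

text \<open>
  Under the rectangle congruences all nine derangement products of a hollow 4 by 4 matrix agree
  modulo the maximal ideal. Three derangements are even and six are odd, so that
  the determinant is congruent to minus three times this common unit.
\<close>

lemma (in real_valuation) val_three_pos_if_hollow_det_eq_0:
  fixes A :: "4 \<Rightarrow> 4 \<Rightarrow> 'a"
  assumes diag: "\<And>i. 0 < val (A i i)"
    and unit: "\<And>i j. i \<noteq> j \<Longrightarrow> val (A i j) = 0"
    and rect: "\<And>i j k n. distinct [i, j, k, n] \<Longrightarrow>
      0 < val (A i k * A j n - A i n * A j k)"
    and "det (\<chi> i j. A i j) = 0"
  shows "0 < val 3"
proof -
  have nonneg: "0 \<le> val (A i j)" for i j
    using diag [of i] unit [of i j] by (cases "i = j") auto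
  \<comment> \<open>Two permutation products that differ by exchanging the columns of two rows share
    their other two factors. They are congruent by one rectangle multiplied by these
    factors.\<close>
  have swap: "0 < val ((A i k * A j n - A i n * A j k) * (A a b * A c d))"
    if "distinct [i, j, k, n]" for i j k n a b c d
    by (intro val_pos_mult rect that) (simp add: val_mult nonneg add_nonneg_nonneg)
  \<comment> \<open>The nine derangements: \<open>?t\<close>, \<open>?t2\<close>, \<open>?t3\<close>
    belong to the double transpositions, which are even, and \<open>?c1\<close> to
    \<open>?c6\<close> to the 4-cycles, which are odd.\<close>
  let ?t = "A 1 2 * A 2 1 * A 3 4 * A 4 3"
    and ?t2 = "A 1 3 * A 3 1 * A 2 4 * A 4 2"
    and ?t3 = "A 1 4 * A 4 1 * A 2 3 * A 3 2"
    and ?c1 = "A 1 2 * A 2 3 * A 3 4 * A 4 1"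
    and ?c2 = "A 1 2 * A 2 4 * A 4 3 * A 3 1"
    and ?c3 = "A 1 3 * A 3 2 * A 2 4 * A 4 1"
    and ?c4 = "A 1 3 * A 3 4 * A 4 2 * A 2 1"
    and ?c5 = "A 1 4 * A 4 2 * A 2 3 * A 3 1"
    and ?c6 = "A 1 4 * A 4 3 * A 3 2 * A 2 1"
  have c6: "0 < val (?c6 - ?t)"
    using swap [of 1 3 4 2 2 1 4 3] by (simp add: algebra_simps)
  have c1: "0 < val (?c1 - ?t)"
    using swap [of 2 4 3 1 1 2 3 4] by (simp add: algebra_simps)
  have c4: "0 < val (?c4 - ?t)"
    using swap [of 1 4 3 2 2 1 3 4] by (simp add: algebra_simps)
  have c2: "0 < val (?c2 - ?t)"
    using swap [of 2 3 4 1 1 2 4 3] by (simp add: algebra_simps)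
  \<comment> \<open>The products \<open>?t2\<close>, \<open>?t3\<close>, \<open>?c3\<close> and
    \<open>?c5\<close> share no entry with \<open>?t\<close>, so they reach it only through a chain
    of exchanges.\<close>
  have t3: "0 < val (?t3 - ?c6)"
    using swap [of 2 4 3 1 1 4 3 2] by (simp add: algebra_simps)
  then have t3: "0 < val (?t3 - ?t)"
    using val_pos_add [OF _ c6] by force
  have t2: "0 < val (?t2 - ?c4)"
    using swap [of 2 3 4 1 1 3 4 2] by (simp add: algebra_simps)
  then have t2: "0 < val (?t2 - ?t)"
    using val_pos_add [OF _ c4] by force
  have c3: "0 < val (?c3 - ?t2)"
    using swap [of 3 4 2 1 1 3 2 4] by (simp add: algebra_simps)
  then have c3: "0 < val (?c3 - ?t)"
    using val_pos_add [OF _ t2] by force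
  have c5: "0 < val (?c5 - ?t3)"
    using swap [of 3 4 1 2 1 4 2 3] by (simp add: algebra_simps)
  then have c5: "0 < val (?c5 - ?t)"
    using val_pos_add [OF _ t3] by force

  \<comment> \<open>The fifteen permutations with a fixed point each contribute a diagonal entry.
    Signs are written as \<open>+ -\<close> so that additivity alone takes the sum apart.\<close>
  have diagonal: "0 < val (
      (A 1 1 * A 2 2 * A 3 3 * A 4 4)
      + - (A 1 1 * A 2 2 * A 3 4 * A 4 3)
      + - (A 1 1 * A 2 3 * A 3 2 * A 4 4)
      + (A 1 1 * A 2 3 * A 3 4 * A 4 2)
      + (A 1 1 * A 2 4 * A 3 2 * A 4 3)
      + - (A 1 1 * A 2 4 * A 3 3 * A 4 2)
      + - (A 1 2 * A 2 1 * A 3 3 * A 4 4)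
      + (A 1 2 * A 2 3 * A 3 1 * A 4 4)
      + (A 1 2 * A 2 4 * A 3 3 * A 4 1)
      + (A 1 3 * A 2 1 * A 3 2 * A 4 4)
      + - (A 1 3 * A 2 2 * A 3 1 * A 4 4)
      + (A 1 3 * A 2 2 * A 3 4 * A 4 1)
      + (A 1 4 * A 2 1 * A 3 3 * A 4 2)
      + (A 1 4 * A 2 2 * A 3 1 * A 4 3)
      + - (A 1 4 * A 2 2 * A 3 3 * A 4 1))" (is "0 < val ?D")
    by (intro val_pos_add; simp add: val_mult diag nonneg add_pos_nonneg add_nonneg_pos)
  \<comment> \<open>The derangements occur in the determinant with signs 3 times plus and 6 times
    minus. Replacing each by \<open>?t\<close> leaves \<open>-3 * ?t\<close>, which is moved to the
    right.\<close>
  have sum: "?D + (?t2 - ?t) + (?t3 - ?t) - (?c1 - ?t) - (?c2 - ?t) - (?c3 - ?t) - (?c4 - ?t)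
      - (?c5 - ?t) - (?c6 - ?t) = det (\<chi> i j. A i j) + 3 * ?t"
    unfolding det_4 by (simp add: algebra_simps)
  have "0 < val (?D + (?t2 - ?t) + (?t3 - ?t) - (?c1 - ?t) - (?c2 - ?t) - (?c3 - ?t)
      - (?c4 - ?t) - (?c5 - ?t) - (?c6 - ?t))"
    by (intro val_pos_add val_pos_diff diagonal t2 t3 c1 c2 c3 c4 c5 c6)
  then have "0 < val (3 * ?t)"
    unfolding sum \<open>det (\<chi> i j. A i j) = 0\<close> add_0_left .
  then show ?thesis
    by (simp add: val_mult unit)
qed

section \<open>Identity submatrices of the incidence matrix\<close>

definition identity_tuples ::
  "('p \<Rightarrow> 'l \<Rightarrow> bool) \<Rightarrow> ((4 \<Rightarrow> 'p) \<times> (4 \<Rightarrow> 'l)) set" where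
  "identity_tuples incid = {(P, L). no_three_collinear incid P \<and>
     (\<forall>i. incid (P i) (L i)) \<and> (\<forall>i j. j \<noteq> i \<longrightarrow> \<not> incid (P j) (L i))}"

lemma N_id_ord_eq_card: "N_id_ord incid = card (identity_tuples incid)"
  by (simp add: N_id_ord_def identity_tuples_def)

section \<open>Cardinality bounds for dependent sums and unions\<close>

lemma card_Sigma_ge:
  assumes "finite A" "\<And>x. x \<in> A \<Longrightarrow> finite (B x)" "\<And>x. x \<in> A \<Longrightarrow> m \<le> card (B x)"
  shows "card A * m \<le> card (Sigma A B)"
  using sum_bounded_below [of A m "\<lambda>x. card (B x)"] assms by (simp add: card_SigmaI)

lemma card_UN_le_mult:
  assumes "finite I" "\<And>i. i \<in> I \<Longrightarrow> card (T i) \<le> m"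
  shows "card (\<Union>i\<in>I. T i) \<le> card I * m"
  using card_UN_le [OF assms(1), of T] sum_bounded_above [of I "\<lambda>i. card (T i)" m] assms(2)
  by simp

lemma no_three_collinear_inj: "no_three_collinear incid P \<Longrightarrow> P i = P j \<longleftrightarrow> i = j"
  by (auto simp: no_three_collinear_def inj_def)

context projective_plane
begin

section \<open>A lower bound of order \<open>q ^ 12\<close> for the number of identity
  submatrices\<close>

lemma card_common_lines:
  assumes "p \<noteq> p'"
  shows "card {l. incid p l \<and> incid p' l} = 1"
proof -
  obtain l where "\<And>l'. incid p l' \<and> incid p' l' \<longleftrightarrow> l' = l"
    using unique_line [OF assms] by metis
  then show ?thesis
    by simp
qed

lemma card_collinear:
  assumes "a \<noteq> b"
  shows "card {x. \<exists>l. incid a l \<and> incid b l \<and> incid x l} = q + 1"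
proof -
  obtain l where "\<And>l'. incid a l' \<and> incid b l' \<longleftrightarrow> l' = l"
    using unique_line [OF assms] by metis
  then have "{x. \<exists>l. incid a l \<and> incid b l \<and> incid x l} = {x. incid x l}"
    unfolding conj_assoc [symmetric] by simp
  then show ?thesis
    by (simp add: card_points_on_line)
qed

text \<open>Each of the other three points rules out only its joining line among the
  \<open>q + 1\<close> lines through \<open>P i\<close>.\<close>

lemma card_separating_lines:
  assumes "inj (P :: 4 \<Rightarrow> 'p)"
  shows "q - 2 \<le> card {l. incid (P i) l \<and> (\<forall>j. j \<noteq> i \<longrightarrow> \<not> incid (P j) l)}"
proof -
  let ?U = "\<Union>j\<in>UNIV - {i}. {l. incid (P i) l \<and> incid (P j) l}"
  have "card ?U \<le> card (UNIV - {i}) * 1"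
    by (rule card_UN_le_mult) (use assms card_common_lines in \<open>auto simp: inj_eq\<close>)
  then have "card ?U \<le> 3"
    by (simp add: card_Diff_singleton)
  then have "q + 1 - 3 \<le> card ({l. incid (P i) l} - ?U)"
    using diff_card_le_card_Diff [of ?U "{l. incid (P i) l}"] card_lines_through_point [of "P i"]
    by simp
  also have "{l. incid (P i) l} - ?U = {l. incid (P i) l \<and> (\<forall>j. j \<noteq> i \<longrightarrow> \<not> incid (P j) l)}"
    by auto
  finally show ?thesis
    by simp
qed

text \<open>The points are chosen in turn: any \<open>a\<close>, then \<open>b\<close> other than
  \<open>a\<close>, then \<open>c\<close> off the line \<open>ab\<close>, then \<open>d\<close> off
  the three sides of the triangle.\<close>

lemma card_quadrangles_ge:
  "(q\<^sup>2 + q + 1) * (q\<^sup>2 + q) * q\<^sup>2 * (q\<^sup>2 + q + 1 - 3 * (q + 1)) \<le> card {P. no_three_collinear incid P}"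
proof -
  define col where "col = (\<lambda>a b. {x. \<exists>l. incid a l \<and> incid b l \<and> incid x l})"
  define D where "D = (\<lambda>(a, b, c). UNIV - (col a b \<union> col a c \<union> col b c))"
  define T3 where "T3 = (SIGMA (a, b) : (SIGMA a : UNIV. UNIV - {a}). UNIV - col a b)"
  define T where "T = (SIGMA ((a, b), c) : T3. D (a, b, c))"
  define f where "f = (\<lambda>(((a, b), c), d) (i :: 4). if i = 1 then a else if i = 2 then b
    else if i = 3 then c else (d :: 'p))"
  \<comment> \<open>With this, avoiding \<open>col a b\<close> already means avoiding
    \<open>a\<close> and \<open>b\<close>, which gives the distinctness of the four points.\<close>
  have mem: "a \<in> col a b" "b \<in> col a b" for a b
  proof -
    have "\<exists>l. incid a l \<and> incid b l"
    proof (cases "a = b")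
      case True
      have "{l. incid a l} \<noteq> {}"
        using card_lines_through_point [of a] by (metis Suc_eq_plus1 card.empty nat.distinct(1))
      with True show ?thesis by auto
    qed (use unique_line in blast)
    then show "a \<in> col a b" "b \<in> col a b"
      by (auto simp: col_def)
  qed
  have card_col: "card (col a b) = q + 1" if "a \<noteq> b" for a b
    using card_collinear [OF that] by (simp add: col_def)
  have card_Compl: "card (UNIV - A) = q\<^sup>2 + q + 1 - card A" for A :: "'p set"
    by (simp add: card_Diff_subset card_points)
  have "card (SIGMA a: (UNIV :: 'p set). UNIV - {a}) = (q\<^sup>2 + q + 1) * (q\<^sup>2 + q)"
    by (simp add: card_Compl card_points)
  moreover have "card (SIGMA a: (UNIV :: 'p set). UNIV - {a}) * q\<^sup>2 \<le> card T3"
    unfolding T3_def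
  proof (rule card_Sigma_ge)
    fix x
    assume "x \<in> (SIGMA a: (UNIV :: 'p set). UNIV - {a})"
    then obtain a b where "x = (a, b)" "a \<noteq> b"
      by auto
    then show "q\<^sup>2 \<le> card (case x of (a, b) \<Rightarrow> UNIV - col a b)"
      by (simp add: card_Compl card_col)
  qed auto
  moreover have "card T3 * (q\<^sup>2 + q + 1 - 3 * (q + 1)) \<le> card T"
    unfolding T_def
  proof (rule card_Sigma_ge)
    fix x
    assume "x \<in> T3"
    then obtain a b c where x: "x = ((a, b), c)" "b \<noteq> a" "c \<notin> col a b"
      by (auto simp: T3_def)
    then have ne: "a \<noteq> c" "b \<noteq> c"
      using mem by auto
    \<comment> \<open>A crude union bound: the vertices that the sides share are counted
      twice.\<close>
    have "card (col a b \<union> col a c \<union> col b c) \<le> card (col a b) + card (col a c) + card (col b c)"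
      by (meson add_le_mono1 card_Un_le order_trans)
    also have "\<dots> = 3 * (q + 1)"
      using x(2) ne by (simp add: card_col)
    finally show "q\<^sup>2 + q + 1 - 3 * (q + 1) \<le> card (case x of (x, xa) \<Rightarrow> (case x of (a, b) \<Rightarrow> \<lambda>c. D (a, b, c)) xa)"
      unfolding x by (simp add: D_def card_Compl diff_le_mono2)
  qed auto
  moreover have "card T \<le> card {P. no_three_collinear incid P}"
  proof (rule card_inj_on_le)
    show "inj_on f T"
    proof (rule inj_onI)
      fix x y
      assume "f x = f y"
      then have "\<forall>i. f x i = f y i" by simp
      then show "x = y"
        unfolding forall_4 by (cases x; cases y) (auto simp: f_def)
    qed
    show "f ` T \<subseteq> {P. no_three_collinear incid P}"
    proof clarify
      fix a b c d
      assume "(((a, b), c), d) \<in> T"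
      then have T: "b \<noteq> a" "c \<notin> col a b" "d \<notin> col a b" "d \<notin> col a c" "d \<notin> col b c"
        by (auto simp: T_def T3_def D_def)
      then have "distinct [a, b, c, d]"
        using mem by auto
      moreover have "\<not> (incid a l \<and> incid b l \<and> incid c l)" "\<not> (incid a l \<and> incid b l \<and> incid d l)"
        "\<not> (incid a l \<and> incid c l \<and> incid d l)" "\<not> (incid b l \<and> incid c l \<and> incid d l)" for l
        using T by (auto simp: col_def)
      ultimately show "no_three_collinear incid (f (((a, b), c), d))"
        unfolding no_three_collinear_def inj_def forall_4 by (simp add: f_def) blast
    qed
  qed auto
  ultimately show ?thesis
    by (metis (no_types, lifting) le_trans mult_le_mono1)
qed

text \<open>Once the points are fixed, the conditions on the four lines are independent of each
  other, so the choices form a product.\<close>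

lemma card_identity_tuples_ge:
  "card {P. no_three_collinear incid P} * (q - 2) ^ 4 \<le> card (identity_tuples incid)"
proof -
  define S where "S = (\<lambda>(P :: 4 \<Rightarrow> 'p) i. {l. incid (P i) l \<and> (\<forall>j. j \<noteq> i \<longrightarrow> \<not> incid (P j) l)})"
  have "identity_tuples incid =
      (SIGMA P : {P. no_three_collinear incid P}. Pi\<^sub>E UNIV (S P))"
    by (auto simp: identity_tuples_def S_def PiE_UNIV_domain)
  moreover have "(q - 2) ^ 4 \<le> card (Pi\<^sub>E UNIV (S P))" if "no_three_collinear incid P" for P
  proof -
    have "inj P"
      using that by (simp add: no_three_collinear_def)
    then have "(\<Prod>i\<in>(UNIV :: 4 set). q - 2) \<le> (\<Prod>i\<in>UNIV. card (S P i))"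
      by (intro prod_mono) (simp add: S_def card_separating_lines)
    then show ?thesis
      by (simp add: card_PiE)
  qed
  ultimately show ?thesis
    using card_Sigma_ge [of "{P. no_three_collinear incid P}" "\<lambda>P. Pi\<^sub>E UNIV (S P)" "(q - 2) ^ 4"]
    by simp
qed

lemma identity_tuples_lower_bound:
  assumes "3 \<le> q"
  shows "real q ^ 12 / 729 \<le> real (card (identity_tuples incid))"
proof -
  let ?r = "real q"
  \<comment> \<open>Ensures that the subtraction of naturals does not truncate.\<close>
  have "3 * q + 3 \<le> q\<^sup>2 + q + 1"
    unfolding power2_eq_square using mult_le_mono1 [OF assms, of q] assms by linarith
  then have r: "real (q\<^sup>2 + q + 1 - 3 * (q + 1)) = ?r\<^sup>2 - 2 * ?r - 2"
    by (simp add: of_nat_diff)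
  have "3 * ?r \<le> ?r\<^sup>2" 
    using assms by (simp add: power2_eq_square)
  \<comment> \<open>The constant 729 is \<open>9 * 3 ^ 4\<close>, from this bound and from
    \<open>q / 3 \<le> q - 2\<close>. Both are equalities at \<open>q = 3\<close>.\<close>
  then have last: "?r\<^sup>2 / 9 \<le> ?r\<^sup>2 - 2 * ?r - 2"
    using assms by (simp add: field_simps)
  have "?r ^ 12 / 729 = (?r\<^sup>2 * ?r\<^sup>2 * ?r\<^sup>2 * (?r\<^sup>2 / 9)) * (?r / 3) ^ 4"
    by (simp add: power_divide flip: power_add power_mult)
  also have "\<dots> \<le> ((?r\<^sup>2 + ?r + 1) * (?r\<^sup>2 + ?r) * ?r\<^sup>2 * (?r\<^sup>2 - 2 * ?r - 2)) * (?r - 2) ^ 4"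
    using assms last by (intro mult_mono power_mono mult_nonneg_nonneg) auto
  also have "\<dots> = real ((q\<^sup>2 + q + 1) * (q\<^sup>2 + q) * q\<^sup>2 * (q\<^sup>2 + q + 1 - 3 * (q + 1)) * (q - 2) ^ 4)"
    unfolding of_nat_mult r using assms by (simp add: of_nat_diff)
  also have "\<dots> \<le> real (card (identity_tuples incid))"
    unfolding of_nat_le_iff
    using mult_le_mono1 [OF card_quadrangles_ge] card_identity_tuples_ge le_trans by blast
  finally show ?thesis .
qed

section \<open>Identity submatrices through a given rectangle\<close>

lemma card_identity_tuples_through_le:
  assumes "distinct [i, j, k, n]"
  shows "card {(P, L) \<in> identity_tuples incid. P i = p \<and> P j = p' \<and> L k = l \<and> L n = m} \<le> (q + 1) ^ 4"
    (is "card ?T \<le> _")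
proof -
  \<comment> \<open>Four distinct indices exhaust the type \<open>4\<close>, so only these two
    points and two lines remain free. Each is confined to a line or a pencil of size
    \<open>q + 1\<close>, by the diagonal incidences.\<close>
  let ?f = "\<lambda>(P, L). (P k, P n, L i, L j)"
  let ?X = "{x. incid x l} \<times> {x. incid x m} \<times> {y. incid p y} \<times> {y. incid p' y}"
  have "card {i, j, k, n} = CARD(4)"
    using assms by simp
  then have "{i, j, k, n} = UNIV"
    by (intro card_eq_UNIV_imp_eq_UNIV) auto
  then have all: "(\<forall>x. Q x) \<longleftrightarrow> Q i \<and> Q j \<and> Q k \<and> Q n" for Q
    by (metis UNIV_I empty_iff insert_iff)
  have "card ?T \<le> card ?X"
  proof (rule card_inj_on_le)
    show "inj_on ?f ?T"
      by (rule inj_onI) (auto simp: fun_eq_iff all)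
    show "?f ` ?T \<subseteq> ?X"
      by (auto simp: identity_tuples_def)
  qed auto
  also have "\<dots> = (q + 1) ^ 4"
    by (simp add: card_cartesian_product card_points_on_line card_lines_through_point
        power4_eq_xxxx mult.assoc)
  finally show ?thesis .
qed

lemma card_identity_tuples_through_rectangle_le:
  assumes "R = {p, p'} \<times> {l, m}"
  shows "card {(P, L) \<in> identity_tuples incid.
      \<exists>i j k n. distinct [i, j, k, n] \<and> R = {P i, P j} \<times> {L k, L n}} \<le> 256 * (q + 1) ^ 4"
proof -
  let ?D = "{(i, j, k, n). distinct [i, j, k, n :: 4]}"
  let ?T = "\<lambda>(i, j, k, n). {(P, L) \<in> identity_tuples incid. P i = p \<and> P j = p' \<and> L k = l \<and> L n = m}"
  have "{(P, L) \<in> identity_tuples incid.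
      \<exists>i j k n. distinct [i, j, k, n] \<and> R = {P i, P j} \<times> {L k, L n}} \<subseteq> (\<Union>x\<in>?D. ?T x)"
  proof clarify
    fix P L i j k n
    assume t: "(P, L) \<in> identity_tuples incid" "distinct [i, j, k, n]" "R = {P i, P j} \<times> {L k, L n}"
    \<comment> \<open>A nonempty product determines its factors, but only as unordered pairs. The
      indices may therefore have to be exchanged within each pair.\<close>
    have "{P i, P j} = {p, p'} \<and> {L k, L n} = {l, m}"
      using trans [OF t(3) [symmetric] assms] unfolding times_eq_iff by blast
    then obtain i' j' k' n' where "P i' = p" "P j' = p'" "L k' = l" "L n' = m"
        "{i', j'} = {i, j}" "{k', n'} = {k, n}"
      unfolding doubleton_eq_iff by metis
    then have "(i', j', k', n') \<in> ?D" "(P, L) \<in> ?T (i', j', k', n')"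
      using t by (auto simp: doubleton_eq_iff)
    then show "(P, L) \<in> (\<Union>x\<in>?D. ?T x)"
      by blast
  qed
  then have "card {(P, L) \<in> identity_tuples incid.
      \<exists>i j k n. distinct [i, j, k, n] \<and> R = {P i, P j} \<times> {L k, L n}} \<le> card (\<Union>x\<in>?D. ?T x)"
    by (rule card_mono [rotated]) simp
  also have "\<dots> \<le> card ?D * (q + 1) ^ 4"
    by (rule card_UN_le_mult) (use card_identity_tuples_through_le in auto)
  \<comment> \<open>The 24 orderings are bounded by all \<open>4 ^ 4\<close> index
    quadruples.\<close>
  also have "card ?D \<le> card (UNIV :: (4 \<times> 4 \<times> 4 \<times> 4) set)"
    by (rule card_mono) auto
  also have "\<dots> = 256"
    by (simp add: card_prod)
  finally show ?thesis
    by simp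
qed

section \<open>Defects in identity submatrices and the final count\<close>

lemma identity_tuple_contains_defect:
  fixes val :: "'a::field \<Rightarrow> ereal" and F :: "'a ^ 'l ^ 'p"
  assumes "real_valuation val" "ring_characteristic (residue_field val) \<noteq> 3"
    and lift: "is_lift val (incidence_matrix incid) F" and rank: "rank F \<le> 3"
    and PL: "(P, L) \<in> identity_tuples incid"
  shows "\<exists>i j k n. distinct [i, j, k, n] \<and> {P i, P j} \<times> {L k, L n} \<in> defect_set incid val F"
proof -
  interpret real_valuation val by fact
  have val_F: "val (F $ x $ y) = (if incid x y then 1 else 0)" for x y
    using lift by (simp add: is_lift_def incidence_matrix_def one_ereal_def zero_ereal_def)
  have inj: "P i = P j \<longleftrightarrow> i = j" for i j
    using PL no_three_collinear_inj by (auto simp: identity_tuples_def)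
  have inc: "incid (P i) (L j) \<longleftrightarrow> i = j" for i j
    using PL by (auto simp: identity_tuples_def)
  define A where "A = (\<lambda>i j. F $ P i $ L j)"
  have "\<not> 0 < val 3"
    using val_of_nat_prime_pos_imp_ring_characteristic [of 3] assms(2) by auto
  moreover have "0 < val (A i i)" for i
    by (simp add: A_def val_F inc)
  moreover have unit: "val (A i j) = 0" if "i \<noteq> j" for i j
    using that by (simp add: A_def val_F inc)
  moreover have "det (\<chi> i j. A i j) = 0"
    unfolding A_def by (rule det_submatrix_eq_0) (use rank in simp)
  \<comment> \<open>Since 3 is a unit of the valuation ring, some rectangle congruence must fail.
    Its rows \<open>i\<close>, \<open>j\<close> and columns \<open>k\<close>, \<open>n\<close> are
    all distinct indices, so its four entries are off the diagonal and hence nonincidences.\<close>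
  ultimately obtain i j k n where ijkn: "distinct [i, j, k, n]"
    and "\<not> 0 < val (A i k * A j n - A i n * A j k)"
    using val_three_pos_if_hollow_det_eq_0 [of A] by blast
  then have "rect_ratio val F (P i) (P j) (L k) (L n) \<noteq> \<one>\<^bsub>residue_field val\<^esub>"
    using residue_product_ratio_eq_one_imp [of "A i k" "A j n" "A i n" "A j k"] unit
    by (auto simp: rect_ratio_def A_def Let_def)
  moreover have "L k \<noteq> L n"
    using inc ijkn by (metis distinct_length_2_or_more)
  then have "is_zero_rectangle incid (P i) (P j) (L k) (L n)"
    using ijkn by (auto simp: is_zero_rectangle_def inj inc)
  ultimately show ?thesis
    using ijkn unfolding defect_set_def by blast
qed

lemma card_identity_tuples_le:
  fixes val :: "'a::field \<Rightarrow> ereal" and F :: "'a ^ 'l ^ 'p"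
  assumes "real_valuation val" "ring_characteristic (residue_field val) \<noteq> 3"
    "is_lift val (incidence_matrix incid) F" "rank F \<le> 3"
  shows "card (identity_tuples incid) \<le> card (defect_set incid val F) * (256 * (q + 1) ^ 4)"
proof -
  let ?T = "\<lambda>R. {(P, L) \<in> identity_tuples incid.
      \<exists>i j k n. distinct [i, j, k, n] \<and> R = {P i, P j} \<times> {L k, L n}}"
  have "identity_tuples incid \<subseteq> (\<Union>R\<in>defect_set incid val F. ?T R)"
    using identity_tuple_contains_defect [OF assms] by fast
  then have "card (identity_tuples incid) \<le> card (\<Union>R\<in>defect_set incid val F. ?T R)"
    by (rule card_mono [rotated]) simp
  also have "\<dots> \<le> card (defect_set incid val F) * (256 * (q + 1) ^ 4)"
  proof (rule card_UN_le_mult)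
    fix R
    assume "R \<in> defect_set incid val F"
    then obtain p p' l m where "R = {p, p'} \<times> {l, m}"
      unfolding defect_set_def by blast
    then show "card (?T R) \<le> 256 * (q + 1) ^ 4"
      by (rule card_identity_tuples_through_rectangle_le)
  qed simp
  finally show ?thesis .
qed

end

theorem theorem5p3:
  fixes incid :: "'p::finite \<Rightarrow> 'l::finite \<Rightarrow> bool"
    and q :: nat
    and val :: "'a::field \<Rightarrow> ereal"
    and F :: "'a ^ 'l ^ 'p"
  assumes "projective_plane incid q"
    and "q \<ge> 3"
    and "real_valuation val"
    and "ring_characteristic (residue_field val) \<noteq> 3"
    and "kapranov_rank val (incidence_matrix incid) \<le> 3"
    and "is_lift val (incidence_matrix incid) F"
    and "rank F \<le> 3"
  shows "real (card (defect_set incid val F)) \<ge>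
           real (N_id_ord incid) / (16 * (fact 4)\<^sup>2 * (real q + 1) ^ 4)
         \<and> real (card (defect_set incid val F)) \<ge> 1 / (300 * (16 * (fact 4)\<^sup>2)) * real q ^ 8"
proof -
  interpret projective_plane incid q by fact
  let ?d = "real (card (defect_set incid val F))" and ?N = "real (N_id_ord incid)"
  let ?Q = "(real q + 1) ^ 4"
  have "?N \<le> real (card (defect_set incid val F) * (256 * (q + 1) ^ 4))"
    unfolding of_nat_le_iff N_id_ord_eq_card by (rule card_identity_tuples_le) fact+
  then have upper: "?N \<le> 256 * (?d * ?Q)"
    by (simp add: algebra_simps)
  \<comment> \<open>The count gives the constant 256, which is relaxed to
    \<open>9216 = 16 * 24\<^sup>2\<close>.\<close>
  have "256 * (?d * ?Q) \<le> 9216 * (?d * ?Q)"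
    by (intro mult_right_mono) auto
  with upper have "?N \<le> ?d * (9216 * ?Q)"
    by (simp add: mult_ac)
  then have "?N / (9216 * ?Q) \<le> ?d"
    by (intro divide_le_eq [THEN iffD2]) auto
  moreover have "1 / (300 * 9216) * real q ^ 8 \<le> ?d"
  proof -
    \<comment> \<open>For \<open>q \<ge> 3\<close>, \<open>q + 1\<close> is at most
      \<open>4 / 3 * q\<close>.\<close>
    have "?Q \<le> (4 / 3 * real q) ^ 4"
      using assms(2) by (intro power_mono) auto
    then have Q: "?Q \<le> 256 / 81 * real q ^ 4"
      by (simp add: power_mult_distrib power_divide)
    have "real q ^ 12 / 729 \<le> 256 * (?d * ?Q)"
      using identity_tuples_lower_bound [OF assms(2)] upper by (simp add: N_id_ord_eq_card)
    also have "\<dots> \<le> 256 * (?d * (256 / 81 * real q ^ 4))"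
      by (intro mult_left_mono Q) auto
    finally have "real q ^ 4 * (real q ^ 8 / 729) \<le> real q ^ 4 * (65536 / 81 * ?d)"
      by (simp add: mult_ac flip: power_add)
    then have "real q ^ 8 / 729 \<le> 65536 / 81 * ?d"
      using assms(2) by (subst (asm) mult_le_cancel_left_pos) auto
    \<comment> \<open>Numerically, \<open>729 * 65536 / 81 = 589824\<close>, which is below
      \<open>300 * 9216 = 2764800\<close>.\<close>
    then show ?thesis
      by simp
  qed
  moreover have "16 * (fact 4)\<^sup>2 = (9216 :: real)"
    by (simp add: fact_numeral)
  ultimately show ?thesis
    by simp
qed

end
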